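(* Let $h\mapsto\hat h$ be an involutive automorphism of the skew field of quaternions $\mathbb H$. Then either it is the identity, or the set of orthogonal imaginary units $i,j,k$ of $\mathbb H$ can be chosen such that $$\hat h= h^{i}:=i^{-1}hi=-ihi=a+bi-cj-dk$$ for each $h=a+bi+cj+dk\in\mathbb H$ $(a,b,c,d\in\mathbb R)$.
   Context: $\mathbb H$ is the skew field of real quaternions. An automorphism $h\mapsto\hat h$ of $\mathbb H$ (a bijection preserving addition and multiplication) is called involutive if $\hat{\hat h}=h$ for all $h\in\mathbb H$; the identity is allowed. "The set of orthogonal imaginary units $i,j,k$ can be chosen" means: there exist $i,j,k\in\mathbb H$ that are pure quaternions of norm $1$, pairwise orthogonal in the space of pure quaternions (identified with $\mathbb R^3$), and satisfy the usual quaternion relations $i^2=j^2=k^2=-1$, $ij=k=-ji$, such that the stated formula holds when every quaternion is written with respect to the real basis $1,i,j,k$. *)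

theory Defs
  imports "HOL-Analysis.Analysis"
begin

section \<open>The skew field of real quaternions\<close>

text \<open>As for the type \<^typ>\<open>complex\<close>, a codatatype gives access to \<open>primcorec\<close>.\<close>

codatatype quat = Quat (qRe: real) (qI: real) (qJ: real) (qK: real)

lemma quat_eq_iff: "x = y \<longleftrightarrow> qRe x = qRe y \<and> qI x = qI y \<and> qJ x = qJ y \<and> qK x = qK y"
  by (auto intro: quat.expand)

instantiation quat :: ab_group_add
begin

primcorec zero_quat where
  "qRe 0 = 0" | "qI 0 = 0" | "qJ 0 = 0" | "qK 0 = 0"

primcorec plus_quat where
  "qRe (x + y) = qRe x + qRe y"
| "qI (x + y) = qI x + qI y"
| "qJ (x + y) = qJ x + qJ y"
| "qK (x + y) = qK x + qK y"

primcorec uminus_quat where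
  "qRe (- x) = - qRe x"
| "qI (- x) = - qI x"
| "qJ (- x) = - qJ x"
| "qK (- x) = - qK x"

primcorec minus_quat where
  "qRe (x - y) = qRe x - qRe y"
| "qI (x - y) = qI x - qI y"
| "qJ (x - y) = qJ x - qJ y"
| "qK (x - y) = qK x - qK y"

instance
  by standard (simp_all add: quat_eq_iff)

end

instantiation quat :: ring_1
begin

primcorec one_quat where
  "qRe 1 = 1" | "qI 1 = 0" | "qJ 1 = 0" | "qK 1 = 0"

primcorec times_quat where
  "qRe (x * y) = qRe x * qRe y - qI x * qI y - qJ x * qJ y - qK x * qK y"
| "qI (x * y) = qRe x * qI y + qI x * qRe y + qJ x * qK y - qK x * qJ y"
| "qJ (x * y) = qRe x * qJ y - qI x * qK y + qJ x * qRe y + qK x * qI y"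
| "qK (x * y) = qRe x * qK y + qI x * qJ y - qJ x * qI y + qK x * qRe y"

instance
  by standard (simp_all add: quat_eq_iff algebra_simps)

end

instantiation quat :: real_algebra_1
begin

primcorec scaleR_quat where
  "qRe (scaleR r x) = r * qRe x"
| "qI (scaleR r x) = r * qI x"
| "qJ (scaleR r x) = r * qJ x"
| "qK (scaleR r x) = r * qK x"

instance
  by standard (simp_all add: quat_eq_iff algebra_simps)

end

text \<open>The inner product is the one making the basis of the constructor orthonormal, so that on
  quaternions with \<^term>\<open>qRe x = 0\<close> it is the standard one of three-dimensional space.\<close>

instantiation quat :: real_inner
begin

definition inner_quat :: "quat \<Rightarrow> quat \<Rightarrow> real" where
  "inner_quat x y = qRe x * qRe y + qI x * qI y + qJ x * qJ y + qK x * qK y"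

definition norm_quat :: "quat \<Rightarrow> real" where
  "norm_quat x = sqrt (inner x x)"

definition sgn_quat :: "quat \<Rightarrow> quat" where
  "sgn_quat x = scaleR (inverse (norm x)) x"

definition dist_quat :: "quat \<Rightarrow> quat \<Rightarrow> real" where
  "dist_quat x y = norm (x - y)"

definition uniformity_quat :: "(quat \<times> quat) filter" where
  "uniformity_quat = (INF e\<in>{0<..}. principal {(x, y). dist x y < e})"

definition open_quat :: "quat set \<Rightarrow> bool" where
  "open_quat U \<longleftrightarrow> (\<forall>x\<in>U. eventually (\<lambda>(x', y). x' = x \<longrightarrow> y \<in> U) uniformity)"

instance
proof
  fix x y z :: quat and r :: real and U :: "quat set"
  show "dist x y = norm (x - y)" by (rule dist_quat_def)
  show "sgn x = scaleR (inverse (norm x)) x" by (rule sgn_quat_def)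
  show "uniformity = (INF e\<in>{0<..}. principal {(x, y :: quat). dist x y < e})"
    by (rule uniformity_quat_def)
  show "open U \<longleftrightarrow> (\<forall>x\<in>U. eventually (\<lambda>(x', y). x' = x \<longrightarrow> y \<in> U) uniformity)"
    by (rule open_quat_def)
  show "inner x y = inner y x" by (simp add: inner_quat_def mult.commute)
  show "inner (x + y) z = inner x z + inner y z" by (simp add: inner_quat_def algebra_simps)
  show "inner (scaleR r x) y = r * inner x y" by (simp add: inner_quat_def algebra_simps)
  show "0 \<le> inner x x" by (simp add: inner_quat_def)
  show "inner x x = 0 \<longleftrightarrow> x = 0"
    by (auto simp: inner_quat_def quat_eq_iff add_nonneg_eq_0_iff)
  show "norm x = sqrt (inner x x)" by (rule norm_quat_def)
qed

end

instantiation quat :: real_normed_div_algebra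
begin

primcorec inverse_quat where
  "qRe (inverse x) = qRe x / inner x x"
| "qI (inverse x) = - qI x / inner x x"
| "qJ (inverse x) = - qJ x / inner x x"
| "qK (inverse x) = - qK x / inner x x"

definition divide_quat :: "quat \<Rightarrow> quat \<Rightarrow> quat" where
  "divide_quat x y = x * inverse y"

instance
proof
  fix x y :: quat
  have *: "qRe x * qRe x + qI x * qI x + qJ x * qJ x + qK x * qK x \<noteq> 0" if "x \<noteq> 0"
    using that inner_eq_zero_iff[of x] by (simp add: inner_quat_def)
  show "inverse x * x = 1" if "x \<noteq> 0"
    using *[OF that]
    by (simp add: quat_eq_iff inner_quat_def flip: add_divide_distrib diff_divide_distrib)
  show "x * inverse x = 1" if "x \<noteq> 0"
    using *[OF that]
    by (simp add: quat_eq_iff inner_quat_def flip: add_divide_distrib diff_divide_distrib)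
  show "x div y = x * inverse y" by (rule divide_quat_def)
  show "inverse (0 :: quat) = 0" by (simp add: quat_eq_iff)
  have "inner (x * y) (x * y) = inner x x * inner y y"
    by (simp add: inner_quat_def) algebra
  then show "norm (x * y) = norm x * norm y"
    by (simp add: norm_eq_sqrt_inner real_sqrt_mult)
qed

end

lemma of_real_quat [simp]:
  "qRe (of_real r) = r" "qI (of_real r) = 0" "qJ (of_real r) = 0" "qK (of_real r) = 0"
  by (simp_all add: of_real_def)


section \<open>Imaginary units and involutive automorphisms\<close>

definition pure_quat :: "quat \<Rightarrow> bool" where
  "pure_quat h \<longleftrightarrow> qRe h = 0"

definition imaginary_units :: "quat \<Rightarrow> quat \<Rightarrow> quat \<Rightarrow> bool" where
  "imaginary_units i j k \<longleftrightarrow>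
     pure_quat i \<and> pure_quat j \<and> pure_quat k \<and>
     norm i = 1 \<and> norm j = 1 \<and> norm k = 1 \<and>
     inner i j = 0 \<and> inner i k = 0 \<and> inner j k = 0 \<and>
     i\<^sup>2 = - 1 \<and> j\<^sup>2 = - 1 \<and> k\<^sup>2 = - 1 \<and>
     i * j = k \<and> j * i = - k"

definition involutive_automorphism :: "(quat \<Rightarrow> quat) \<Rightarrow> bool" where
  "involutive_automorphism \<phi> \<longleftrightarrow>
     bij \<phi> \<and>
     (\<forall>x y. \<phi> (x + y) = \<phi> x + \<phi> y) \<and>
     (\<forall>x y. \<phi> (x * y) = \<phi> x * \<phi> y) \<and>
     (\<forall>x. \<phi> (\<phi> x) = x)"

lemma imaginary_units_standard:
  "imaginary_units (Quat 0 1 0 0) (Quat 0 0 1 0) (Quat 0 0 0 1)"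
  by (simp add: imaginary_units_def pure_quat_def norm_quat_def inner_quat_def quat_eq_iff
      power2_eq_square)

end

theory Submission
  imports Defs
begin

text \<open>An automorphism preserves the centre \<open>\<real>\<close> of \<open>\<H>\<close>, and the only automorphism of the field
  \<open>\<real>\<close> is the identity, so \<open>\<phi>\<close> is real linear. It preserves pure quaternions, as these are the ones
  whose square is a nonpositive real. If \<open>\<phi> \<noteq> id\<close>, some pure unit \<open>j\<close> satisfies \<open>\<phi> j = - j\<close>. For a
  nonzero pure \<open>x\<close> anticommuting with \<open>j\<close>, put \<open>u = x + \<phi> x\<close> if this is nonzero, and \<open>u = x j\<close>
  otherwise. Then \<open>u\<close> is a fixed pure quaternion anticommuting with \<open>j\<close>, and its normalisation is \<open>i\<close>.\<close>

section \<open>The centre of the quaternions and endomorphisms of the real field\<close>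

lemma central_quat_eq_of_real:
  assumes "\<And>x. z * x = x * z"
  shows "z = of_real (qRe z)"
  \<comment> \<open>Commuting with the first unit kills the \<open>qJ\<close> and \<open>qK\<close>
    components, commuting with the second kills \<open>qI\<close>.\<close>
  using assms[of "Quat 0 1 0 0"] assms[of "Quat 0 0 1 0"]
  by (simp add: quat_eq_iff)

lemma of_real_mult_commute_quat: "of_real r * (x :: quat) = x * of_real r"
  by (simp add: quat_eq_iff)

text \<open>The rationals are fixed, and squares go to squares, which makes \<open>f\<close>
  monotone; density of the rationals does the rest.\<close>

lemma real_ring_endomorphism_eq_id:
  fixes f :: "real \<Rightarrow> real"
  assumes add: "\<And>x y. f (x + y) = f x + f y"
    and mult: "\<And>x y. f (x * y) = f x * f y"
    and one: "f 1 = 1"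
  shows "f x = x"
proof -
  interpret additive f by standard (rule add)
  have nat: "f (of_nat n) = of_nat n" for n
    by (induction n) (simp_all add: zero add one)
  have int: "f (of_int n) = of_int n" for n
    by (cases n rule: int_cases2) (simp_all add: nat minus)
  have rat: "f q = q" if Rats: "q \<in> \<rat>" for q
  proof -
    obtain m n where n: "n > 0" and "coprime m n" and q: "q = of_int m / of_int n"
      using Rats by (rule Rats_cases')
    have "f q * of_int n = f (q * of_int n)"
      by (simp add: mult int)
    also have "\<dots> = of_int m"
      using n by (simp add: q int)
    finally show ?thesis
      using n by (simp add: q field_simps)
  qed
  have nonneg: "f y \<ge> 0" if "y \<ge> 0" for y
    using mult[of "sqrt y" "sqrt y"] that by simp
  have mono: "f y \<le> f z" if "y \<le> z" for y z
    using nonneg[of "z - y"] that by (simp add: diff)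
  show ?thesis
  proof (rule antisym; rule ccontr)
    assume "\<not> f x \<le> x"
    then obtain q where "q \<in> \<rat>" "x < q" "q < f x"
      using Rats_dense_in_real[of x "f x"] by auto
    then show False
      using mono[of x q] rat[of q] by simp
  next
    assume "\<not> x \<le> f x"
    then obtain q where "q \<in> \<rat>" "f x < q" "q < x"
      using Rats_dense_in_real[of "f x" x] by auto
    then show False
      using mono[of q x] rat[of q] by simp
  qed
qed

section \<open>Pure quaternions and orthogonality\<close>

lemma pure_quat_square: "pure_quat x \<Longrightarrow> x * x = of_real (- (norm x)\<^sup>2)"
  by (simp add: pure_quat_def quat_eq_iff power2_norm_eq_inner inner_quat_def)

text \<open>The imaginary part of \<open>x * x\<close> is twice \<open>qRe x\<close> times that of
  \<open>x\<close>. If \<open>qRe x\<close> is nonzero, \<open>x\<close> must be real, and its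
  square is positive.\<close>

lemma pure_quat_if_square_nonpos:
  assumes "x * x = of_real r" "r \<le> 0"
  shows "pure_quat x"
proof (rule ccontr)
  assume "\<not> pure_quat x"
  then have "qI x = 0" "qJ x = 0" "qK x = 0" "qRe x * qRe x > 0"
    using assms(1) by (auto simp: pure_quat_def quat_eq_iff zero_less_mult_iff)
  then show False
    using assms by (auto simp: quat_eq_iff)
qed

text \<open>For pure factors, \<open>x * y\<close> is minus the inner product plus the cross
  product, and the latter is antisymmetric.\<close>

lemma pure_quat_anticommutator:
  assumes "pure_quat x" "pure_quat y"
  shows "x * y + y * x = of_real (- 2 * inner x y)"
  using assms by (simp add: pure_quat_def quat_eq_iff inner_quat_def algebra_simps
      del: of_real_minus of_real_mult)

lemma pure_quat_anticommute_iff: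
  assumes "pure_quat x" "pure_quat y"
  shows "x * y = - (y * x) \<longleftrightarrow> inner x y = 0"
  using pure_quat_anticommutator[OF assms]
  by (simp add: eq_neg_iff_add_eq_0 del: of_real_minus of_real_mult)

lemma pure_quat_scaleR: "pure_quat x \<Longrightarrow> pure_quat (scaleR r x)"
  by (simp add: pure_quat_def)

lemma exists_pure_orthogonal_quat:
  obtains x where "x \<noteq> 0" "pure_quat x" "inner x j = 0"
\<comment> \<open>The generic witness is a quarter turn of the projection of \<open>j\<close> to the
  first two imaginary axes; it degenerates when that projection vanishes.\<close>
proof (cases "qI j = 0 \<and> qJ j = 0")
  case True
  then show ?thesis
    by (intro that[of "Quat 0 1 0 0"]) (simp_all add: quat_eq_iff pure_quat_def inner_quat_def)
next
  case False
  then show ?thesis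
    by (intro that[of "Quat 0 (qJ j) (- qI j) 0"])
      (auto simp: quat_eq_iff pure_quat_def inner_quat_def)
qed

section \<open>Systems of imaginary units\<close>

lemma imaginary_unitsI:
  assumes pure: "pure_quat i" "pure_quat j"
    and norm: "norm i = 1" "norm j = 1"
    and anti: "j * i = - (i * j)"
  shows "imaginary_units i j (i * j)"
proof -
  have ij: "inner i j = 0"
    using pure_quat_anticommute_iff[OF pure(2,1)] anti by (simp add: inner_commute)
  have ii: "i * i = -1" and jj: "j * j = -1"
    using pure_quat_square[OF pure(1)] pure_quat_square[OF pure(2)] norm by simp_all
  have pk: "pure_quat (i * j)"
    using ij pure by (simp add: pure_quat_def inner_quat_def)
  have nk: "norm (i * j) = 1"
    by (simp add: norm norm_mult)
  have ik: "i * (i * j) = - j"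
    by (simp add: ii flip: mult.assoc)
  have ki: "i * j * i = j"
    by (simp add: anti ik mult.assoc)
  have kj: "i * j * j = - i"
    by (simp add: jj mult.assoc)
  have jk: "j * (i * j) = i"
    by (simp add: anti kj flip: mult.assoc)
  have "inner i (i * j) = 0" "inner j (i * j) = 0"
    using pure_quat_anticommute_iff[OF pure(1) pk] pure_quat_anticommute_iff[OF pure(2) pk]
    by (simp_all add: ik ki kj jk)
  moreover have "i * j * (i * j) = -1"
    using pure_quat_square[OF pk] nk by simp
  ultimately show ?thesis
    using pure norm pk nk ij ii jj anti
    by (simp add: imaginary_units_def power2_eq_square)
qed

text \<open>The remainder \<open>w\<close> of the orthogonal expansion is pure and orthogonal to all
  three units, so it anticommutes with each of them; only zero does.\<close>

lemma imaginary_units_span: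
  assumes "imaginary_units i j k"
  shows "h = of_real (qRe h) + of_real (inner h i) * i + of_real (inner h j) * j
    + of_real (inner h k) * k"
proof -
  define w where "w = h - (of_real (qRe h) + of_real (inner h i) * i + of_real (inner h j) * j
    + of_real (inner h k) * k)"
  have pure: "pure_quat i" "pure_quat j" "pure_quat k"
    and orth: "inner i j = 0" "inner i k = 0" "inner j k = 0"
    and norm: "norm i = 1" "norm j = 1" "norm k = 1"
    and ij: "i * j = k"
    using assms by (auto simp: imaginary_units_def)
  have unit: "inner i i = 1" "inner j j = 1" "inner k k = 1"
    using norm by (simp_all add: norm_eq_1)
  have one: "inner (of_real r) i = 0" "inner (of_real r) j = 0" "inner (of_real r) k = 0" for r
    using pure by (simp_all add: inner_quat_def pure_quat_def)
  have pw: "pure_quat w"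
    using pure by (simp add: w_def pure_quat_def)
  have "inner w i = 0" "inner w j = 0" "inner w k = 0"
    using orth unit
    by (simp_all add: w_def inner_diff_left inner_add_left one inner_commute[of j i]
        inner_commute[of k i] inner_commute[of k j] flip: scaleR_conv_of_real)
  then have wi: "w * i = - (i * w)" and wj: "w * j = - (j * w)" and wk: "w * k = - (k * w)"
    using pure_quat_anticommute_iff[OF pw] pure by simp_all
  \<comment> \<open>Anticommuting with \<open>i\<close> and \<open>j\<close>, \<open>w\<close> commutes with \<open>k = i j\<close>.\<close>
  have "w * k = w * i * j"
    by (simp add: ij mult.assoc)
  also have "\<dots> = - (i * (w * j))"
    by (simp add: wi mult.assoc)
  also have "\<dots> = k * w"
    by (simp add: wj ij flip: mult.assoc)
  finally have "scaleR 2 (k * w) = 0"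
    \<comment> \<open>Both commuting and anticommuting with \<open>k\<close> forces
      \<open>k * w\<close> to equal its own negative.\<close>
    using wk by (metis add.right_inverse scaleR_2)
  then have "k * w = 0"
    by simp
  then have "w = 0"
    using norm(3) by auto
  then show ?thesis
    by (simp add: w_def)
qed

lemma imaginary_units_conjugation:
  assumes "imaginary_units i j k"
  shows "inverse i = - i"
    and "- i * (of_real a + of_real b * i + of_real c * j + of_real d * k) * i =
      of_real a + of_real b * i - of_real c * j - of_real d * k"
proof -
  have ii: "i * i = -1" and ij: "i * j = k" and ji: "j * i = - k"
    using assms by (auto simp: imaginary_units_def power2_eq_square)
  show "inverse i = - i"
    by (rule inverse_unique) (simp add: ii)
  have k: "i * k = - j"
    by (simp add: ii flip: ij mult.assoc)
  have ki: "k * i = j"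
    by (simp add: ji k mult.assoc flip: ij) (simp add: ij k)
  have "- i * i * i = i" "- i * j * i = - j" "- i * k * i = - k"
    by (simp_all add: ii ij k ji ki)
  \<comment> \<open>With the coefficients written as scalars, they pass through both factors, and
    only the conjugates of the basis remain.\<close>
  moreover have "- i * (of_real a + of_real b * i + of_real c * j + of_real d * k) * i =
      scaleR a (- i * i) + scaleR b (- i * i * i) + scaleR c (- i * j * i) + scaleR d (- i * k * i)"
    by (simp add: distrib_left distrib_right left_diff_distrib of_real_def)
  ultimately show "- i * (of_real a + of_real b * i + of_real c * j + of_real d * k) * i =
      of_real a + of_real b * i - of_real c * j - of_real d * k"
    by (simp add: ii of_real_def)
qed

section \<open>Involutive automorphisms and their eigenvectors\<close>

context
  fixes \<phi> :: "quat \<Rightarrow> quat"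
  assumes invol: "involutive_automorphism \<phi>"
begin

lemma aut_add: "\<phi> (x + y) = \<phi> x + \<phi> y"
  and aut_mult: "\<phi> (x * y) = \<phi> x * \<phi> y"
  and aut_aut: "\<phi> (\<phi> x) = x"
  using invol by (auto simp: involutive_automorphism_def)

interpretation additive \<phi>
  by standard (rule aut_add)

lemma aut_one: "\<phi> 1 = 1"
  using aut_mult[of "\<phi> 1" 1] by (simp add: aut_aut)

lemma aut_of_real: "\<phi> (of_real r) = of_real r"
proof -
  define f where "f r = qRe (\<phi> (of_real r))" for r
  have f: "\<phi> (of_real r) = of_real (f r)" for r
    unfolding f_def
  proof (rule central_quat_eq_of_real)
    fix x
    show "\<phi> (of_real r) * x = x * \<phi> (of_real r)"
      \<comment> \<open>Every \<open>x\<close> is the image of \<open>\<phi> x\<close>, so images of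
        reals commute with everything.\<close>
      using arg_cong[OF of_real_mult_commute_quat[of r "\<phi> x"], of \<phi>]
      by (simp add: aut_mult aut_aut)
  qed
  have "f r = r"
  proof (rule real_ring_endomorphism_eq_id)
    show "f (x + y) = f x + f y" for x y
      by (simp add: f_def aut_add)
    show "f (x * y) = f x * f y" for x y
      using f[of x] f[of y] by (simp add: f_def[of "x * y"] aut_mult)
    show "f 1 = 1"
      by (simp add: f_def aut_one)
  qed
  then show ?thesis
    by (simp add: f)
qed

lemma aut_scaleR: "\<phi> (scaleR r x) = scaleR r (\<phi> x)"
  by (simp add: scaleR_conv_of_real aut_mult aut_of_real)

lemma aut_pure:
  assumes "pure_quat x"
  shows "pure_quat (\<phi> x)"
proof (rule pure_quat_if_square_nonpos)
  show "\<phi> x * \<phi> x = of_real (- (norm x)\<^sup>2)"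
    using arg_cong[OF pure_quat_square[OF assms], of \<phi>] by (simp only: aut_mult aut_of_real)
qed simp

lemma exists_negated_pure_unit:
  assumes "\<phi> \<noteq> id"
  obtains j where "pure_quat j" "norm j = 1" "\<phi> j = - j"
proof -
  obtain h where h: "\<phi> h \<noteq> h"
    using assms by (auto simp: fun_eq_iff)
  \<comment> \<open>The real part is fixed, so the pure part of \<open>h\<close> is also
    moved.\<close>
  define p where "p = h - of_real (qRe h)"
  have "pure_quat p"
    by (simp add: p_def pure_quat_def)
  then have "pure_quat (\<phi> p)"
    by (rule aut_pure)
  have "\<phi> p \<noteq> p"
    using h by (simp add: p_def diff aut_of_real)
  \<comment> \<open>Antisymmetrising lands in the eigenspace of -1.\<close>
  define y where "y = p - \<phi> p"
  have "y \<noteq> 0" "\<phi> y = - y" "pure_quat y"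
    using \<open>\<phi> p \<noteq> p\<close> \<open>pure_quat p\<close> \<open>pure_quat (\<phi> p)\<close>
    by (auto simp: y_def diff aut_aut pure_quat_def)
  then show ?thesis
    by (intro that[of "sgn y"])
      (simp_all add: pure_quat_scaleR aut_scaleR norm_sgn sgn_div_norm)
qed

lemma exists_fixed_pure_unit:
  assumes j: "pure_quat j" "norm j = 1" "\<phi> j = - j"
  obtains i where "pure_quat i" "norm i = 1" "\<phi> i = i" "j * i = - (i * j)"
proof -
  obtain x where x: "x \<noteq> 0" "pure_quat x" "inner x j = 0"
    by (rule exists_pure_orthogonal_quat)
  then have xj: "x * j = - (j * x)"
    using j by (simp add: pure_quat_anticommute_iff)
  obtain u where u: "u \<noteq> 0" "pure_quat u" "\<phi> u = u" "j * u = - (u * j)"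
  proof (cases "x + \<phi> x = 0")
    case False
    \<comment> \<open>As \<open>\<phi>\<close> negates \<open>j\<close>, the sign appears on both
      sides, so \<open>\<phi> x\<close> inherits the anticommutation with \<open>j\<close>.\<close>
    have "- (\<phi> x * j) = j * \<phi> x"
      using arg_cong[OF xj, of \<phi>] by (simp add: aut_mult minus j)
    then have "\<phi> x * j = - (j * \<phi> x)"
      by (metis minus_minus)
    with False show ?thesis
      using x aut_pure[OF x(2)] xj
      by (intro that[of "x + \<phi> x"])
        (auto simp: aut_add aut_aut add.commute pure_quat_def distrib_left distrib_right)
  next
    case True
    then have "\<phi> x = - x"
      by (simp add: eq_neg_iff_add_eq_0 add.commute)
    show ?thesis
    \<comment> \<open>Both factors are negated, so the product is fixed; its real part is minus
      \<open>inner x j\<close>, hence zero.\<close>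
    proof (rule that[of "x * j"])
      show "x * j \<noteq> 0"
        using x j by auto
      show "pure_quat (x * j)"
        using x j by (simp add: pure_quat_def inner_quat_def)
      show "\<phi> (x * j) = x * j"
        by (simp add: aut_mult j \<open>\<phi> x = - x\<close>)
      have "j * x = - (x * j)"
        using xj by simp
      then show "j * (x * j) = - (x * j * j)"
        by (simp flip: mult.assoc)
    qed
  qed
  then show ?thesis
    by (intro that[of "sgn u"])
      (simp_all add: pure_quat_scaleR aut_scaleR norm_sgn sgn_div_norm)
qed

end

theorem lemma1:
  fixes \<phi> :: "quat \<Rightarrow> quat"
  assumes "involutive_automorphism \<phi>"
  shows "\<phi> = id \<or>
    (\<exists>i j k. imaginary_units i j k \<and>
      (\<forall>h. \<exists>a b c d. h = of_real a + of_real b * i + of_real c * j + of_real d * k) \<and>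
      (\<forall>h a b c d. h = of_real a + of_real b * i + of_real c * j + of_real d * k \<longrightarrow>
         \<phi> h = inverse i * h * i \<and>
         inverse i * h * i = - i * h * i \<and>
         - i * h * i = of_real a + of_real b * i - of_real c * j - of_real d * k))"
proof (cases "\<phi> = id")
  case False
  then obtain j where j: "pure_quat j" "norm j = 1" "\<phi> j = - j"
    using exists_negated_pure_unit[OF assms] by blast
  then obtain i where i: "pure_quat i" "norm i = 1" "\<phi> i = i" "j * i = - (i * j)"
    using exists_fixed_pure_unit[OF assms] by blast
  define k where "k = i * j"
  have units: "imaginary_units i j k"
    unfolding k_def using i j by (intro imaginary_unitsI)
  \<comment> \<open>With \<open>i\<close> fixed and \<open>j\<close> negated, the sign of
    \<open>k\<close> is determined, and \<open>\<phi>\<close> agrees with conjugation by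
    \<open>i\<close> on the whole basis.\<close>
  have "\<phi> k = - k"
    by (simp add: k_def aut_mult[OF assms] i j)
  then have "\<phi> (of_real a + of_real b * i + of_real c * j + of_real d * k) =
      of_real a + of_real b * i - of_real c * j - of_real d * k" for a b c d
    by (simp add: aut_add[OF assms] aut_mult[OF assms] aut_of_real[OF assms] i j)
  then have "\<forall>h a b c d. h = of_real a + of_real b * i + of_real c * j + of_real d * k \<longrightarrow>
      \<phi> h = inverse i * h * i \<and> inverse i * h * i = - i * h * i \<and>
      - i * h * i = of_real a + of_real b * i - of_real c * j - of_real d * k"
    by (intro allI impI) (simp only: imaginary_units_conjugation[OF units] simp_thms)
  moreover have "\<forall>h. \<exists>a b c d. h = of_real a + of_real b * i + of_real c * j + of_real d * k"
    using imaginary_units_span[OF units] by blast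
  ultimately show ?thesis
    using units by (intro disjI2 exI) (rule conjI[OF _ conjI])
qed simp

end
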